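(* Let $(A_n,B_n)_{n\ge2}$ be the twin Seidel matrix sequence, $B_n=(b_n(m,k))$. Then, as formal power series in $x,y,z$, $$\sum b_{2n+1}(m,k)\frac{x^{m-1}}{(m-1)!}\frac{y^{k-m-1}}{(k-m-1)!}\frac{z^{2n-k}}{(2n-k)!}=\frac{\sin x\,\cos z\,\sin(x+y+z)}{\cos^2(x+y+z)},$$ the sum being over all integers $n\ge1$, $m,k$ with $2\le m+1\le k\le 2n$, and $$\sum b_{2n+1}(m,k)\frac{x^{2n-m}}{(2n-m)!}\frac{y^{m-k-1}}{(m-k-1)!}\frac{z^{k-1}}{(k-1)!}=-\frac{\sin x\,\sin z}{\cos(x+y+z)}+\frac{\cos x\,\cos(x+y)}{\cos^2(x+y+z)},$$ the sum being over all integers $n\ge1$, $m,k$ with $2\le k+1\le m\le 2n$.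
   Context: Twin Seidel matrix sequence: the unique sequence of square matrices $A_n=(a_n(m,k))_{1\le m,k\le n}$, $B_n=(b_n(m,k))_{1\le m,k\le n}$ ($n\ge2$) with nonnegative integer entries satisfying, with $a_n(m,\bullet)=\sum_k a_n(m,k)$, $a_n(\bullet,k)=\sum_m a_n(m,k)$ and similarly for $b$: (TS1) all diagonal entries are $0$, except $a_2(1,1)=1$; (TS2) for $n\ge3$: $a_n(m,n)=b_n(m,n)=0$ for all $m$, $a_n(n,k)=b_n(1,k)=0$ for all $k$, and $b_n(n,1)=0$; (TS3) $A_2=\begin{pmatrix}1&0\\0&0\end{pmatrix}$, $B_2=\begin{pmatrix}0&0\\1&0\end{pmatrix}$; (TS4) for $n\ge3$: $b_n(n,k)=a_{n-1}(\bullet,k-1)$ for $2\le k\le n-1$; $b_n(n-1,k)=a_{n-1}(\bullet,k)$ for $1\le k\le n-2$; $b_n(m+1,k)-b_n(m,k)=a_{n-1}(m,k)$ for $2\le k+1\le m\le n-2$; $b_n(m+1,k)-b_n(m,k)=a_{n-1}(m,k-1)$ for $3\le m+2\le k\le n-1$; (TS5) for $n\ge3$: $a_n(1,k)=b_{n-1}(\bullet,k-1)$ for $2\le k\le n-1$; $a_n(m+1,k)-a_n(m,k)=-b_{n-1}(m,k-1)$ for $3\le m+2\le k\le n-1$; $a_n(m+1,k)-a_n(m,k)=-b_{n-1}(m,k)$ for $2\le k+1\le m\le n-1$. *)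

theory Defs
  imports "HOL-Computational_Algebra.Formal_Power_Series"
begin

unbundle fps_syntax

text \<open>
  A pair of sequences of matrices is a pair of functions \<open>a\<close>, \<open>b\<close>, where \<open>a n m k\<close> is the entry of
  \<open>A\<^sub>n\<close> in row \<open>m\<close> and column \<open>k\<close>, both indices running over \<open>{1..n}\<close>, and \<open>n \<ge> 2\<close>.  All other values
  of \<open>a\<close>, \<open>b\<close> are irrelevant.
\<close>

definition col_sum :: "nat \<Rightarrow> (nat \<Rightarrow> nat \<Rightarrow> nat) \<Rightarrow> nat \<Rightarrow> nat" where
  "col_sum n M k = (\<Sum>m = 1..n. M m k)"

definition twin_seidel :: "(nat \<Rightarrow> nat \<Rightarrow> nat \<Rightarrow> nat) \<Rightarrow> (nat \<Rightarrow> nat \<Rightarrow> nat \<Rightarrow> nat) \<Rightarrow> bool" where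
  "twin_seidel a b \<longleftrightarrow>
    a 2 1 1 = 1 \<and>
    (\<forall>n m. 2 \<le> n \<and> 1 \<le> m \<and> m \<le> n \<and> (n, m) \<noteq> (2, 1) \<longrightarrow> a n m m = 0) \<and>
    (\<forall>n m. 2 \<le> n \<and> 1 \<le> m \<and> m \<le> n \<longrightarrow> b n m m = 0) \<and>
    (\<forall>n m. 3 \<le> n \<and> 1 \<le> m \<and> m \<le> n \<longrightarrow> a n m n = 0 \<and> b n m n = 0) \<and>
    (\<forall>n k. 3 \<le> n \<and> 1 \<le> k \<and> k \<le> n \<longrightarrow> a n n k = 0 \<and> b n 1 k = 0) \<and>
    (\<forall>n. 3 \<le> n \<longrightarrow> b n n 1 = 0) \<and>
    (a 2 1 1 = 1 \<and> a 2 1 2 = 0 \<and> a 2 2 1 = 0 \<and> a 2 2 2 = 0) \<and>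
    (b 2 1 1 = 0 \<and> b 2 1 2 = 0 \<and> b 2 2 1 = 1 \<and> b 2 2 2 = 0) \<and>
    (\<forall>n k. 3 \<le> n \<and> 2 \<le> k \<and> k \<le> n - 1 \<longrightarrow>
       b n n k = col_sum (n - 1) (a (n - 1)) (k - 1)) \<and>
    (\<forall>n k. 3 \<le> n \<and> 1 \<le> k \<and> k \<le> n - 2 \<longrightarrow>
       b n (n - 1) k = col_sum (n - 1) (a (n - 1)) k) \<and>
    (\<forall>n m k. 3 \<le> n \<and> 2 \<le> k + 1 \<and> k + 1 \<le> m \<and> m \<le> n - 2 \<longrightarrow>
       int (b n (m + 1) k) - int (b n m k) = int (a (n - 1) m k)) \<and>
    (\<forall>n m k. 3 \<le> n \<and> 3 \<le> m + 2 \<and> m + 2 \<le> k \<and> k \<le> n - 1 \<longrightarrow>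
       int (b n (m + 1) k) - int (b n m k) = int (a (n - 1) m (k - 1))) \<and>
    (\<forall>n k. 3 \<le> n \<and> 2 \<le> k \<and> k \<le> n - 1 \<longrightarrow>
       a n 1 k = col_sum (n - 1) (b (n - 1)) (k - 1)) \<and>
    (\<forall>n m k. 3 \<le> n \<and> 3 \<le> m + 2 \<and> m + 2 \<le> k \<and> k \<le> n - 1 \<longrightarrow>
       int (a n (m + 1) k) - int (a n m k) = - int (b (n - 1) m (k - 1))) \<and>
    (\<forall>n m k. 3 \<le> n \<and> 2 \<le> k + 1 \<and> k + 1 \<le> m \<and> m \<le> n - 1 \<longrightarrow>
       int (a n (m + 1) k) - int (a n m k) = - int (b (n - 1) m k))"

text \<open>The recursion determines the sequence: it has a solution, unique on the relevant indices.\<close>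

lemma twin_seidel_exists: "\<exists>a b. twin_seidel a b"
proof -
  define upd :: "nat \<Rightarrow> (nat \<Rightarrow> nat \<Rightarrow> nat) \<times> (nat \<Rightarrow> nat \<Rightarrow> nat) \<Rightarrow> (nat \<Rightarrow> nat \<Rightarrow> nat) \<times> (nat \<Rightarrow> nat \<Rightarrow> nat)"
    where "upd n p =
      (\<lambda>m k. if m < k \<and> k \<le> n - 1 then \<Sum>i = m..n - 1. snd p i (k - 1)
             else if k < m then \<Sum>i = m..n - 1. snd p i k else 0,
       \<lambda>m k. if m < k \<and> k \<le> n - 1 then \<Sum>i = 1..<m. fst p i (k - 1)
             else if k < m \<and> m = n then (if k = 1 then 0 else \<Sum>i = 1..n - 1. fst p i (k - 1))
             else if k < m then (\<Sum>i = 1..<m. fst p i k) + fst p (n - 1) k else 0)" for n p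
  define s :: "nat \<Rightarrow> (nat \<Rightarrow> nat \<Rightarrow> nat) \<times> (nat \<Rightarrow> nat \<Rightarrow> nat)"
    where "s = rec_nat (\<lambda>m k. if m = 1 \<and> k = 1 then 1 else 0, \<lambda>m k. if m = 2 \<and> k = 1 then 1 else 0)
                 (\<lambda>j p. upd (j + 3) p)"
  define a b where "a n = fst (s (n - 2))" and "b n = snd (s (n - 2))" for n
  have a2: "a 2 = (\<lambda>m k. if m = 1 \<and> k = 1 then 1 else 0)"
    and b2: "b 2 = (\<lambda>m k. if m = 2 \<and> k = 1 then 1 else 0)"
    by (simp_all add: a_def b_def s_def)
  have rec: "a n = fst (upd n (a (n - 1), b (n - 1)))" "b n = snd (upd n (a (n - 1), b (n - 1)))"
    if n: "3 \<le> n" for n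
  proof -
    from n obtain j where j: "n = j + 3" by (metis add.commute le_Suc_ex)
    show "a n = fst (upd n (a (n - 1), b (n - 1)))" "b n = snd (upd n (a (n - 1), b (n - 1)))"
      by (simp_all add: a_def b_def s_def j eval_nat_numeral)
  qed
  note ra = rec(1)[unfolded upd_def fst_conv snd_conv]
  note rb = rec(2)[unfolded upd_def fst_conv snd_conv]
  have f1: "a n m m = 0" if "2 \<le> n" "1 \<le> m" "m \<le> n" "(n, m) \<noteq> (2, 1)" for n m
    using that by (cases "n = 2") (auto simp: a2 ra)
  have f2: "b n m m = 0" if "2 \<le> n" "1 \<le> m" "m \<le> n" for n m
    using that by (cases "n = 2") (auto simp: b2 rb)
  have f3: "a n m n = 0 \<and> b n m n = 0" if "3 \<le> n" "1 \<le> m" "m \<le> n" for n m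
    using that by (auto simp: ra rb)
  have f4: "a n n k = 0 \<and> b n 1 k = 0" if "3 \<le> n" "1 \<le> k" "k \<le> n" for n k
    using that by (auto simp: ra rb)
  have f5: "b n n 1 = 0" if "3 \<le> n" for n
    using that by (auto simp: rb)
  have f6: "b n n k = col_sum (n - 1) (a (n - 1)) (k - 1)" if "3 \<le> n" "2 \<le> k" "k \<le> n - 1" for n k
    using that by (auto simp: rb col_sum_def)
  have f7: "b n (n - 1) k = col_sum (n - 1) (a (n - 1)) k" if "3 \<le> n" "1 \<le> k" "k \<le> n - 2" for n k
  proof -
    have "{1..n - 1} = insert (n - 1) {1..<n - 1}" using that by auto
    moreover have "k < n - 1" "n - 1 \<noteq> n" using that by auto
    ultimately show ?thesis using that(1) by (simp add: rb col_sum_def)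
  qed
  have f8: "int (b n (m + 1) k) - int (b n m k) = int (a (n - 1) m k)"
    if "3 \<le> n" "2 \<le> k + 1" "k + 1 \<le> m" "m \<le> n - 2" for n m k
  proof -
    have "{1..<m + 1} = insert m {1..<m}" using that by auto
    moreover have "m + 1 \<noteq> n" "m \<noteq> n" using that by auto
    ultimately show ?thesis using that by (simp add: rb)
  qed
  have f9: "int (b n (m + 1) k) - int (b n m k) = int (a (n - 1) m (k - 1))"
    if "3 \<le> n" "3 \<le> m + 2" "m + 2 \<le> k" "k \<le> n - 1" for n m k
  proof -
    have "{1..<m + 1} = insert m {1..<m}" using that by auto
    moreover have "m + 1 \<noteq> n" "m \<noteq> n" using that by auto
    ultimately show ?thesis using that by (simp add: rb)
  qed
  have f10: "a n 1 k = col_sum (n - 1) (b (n - 1)) (k - 1)" if "3 \<le> n" "2 \<le> k" "k \<le> n - 1" for n k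
    using that by (auto simp: ra col_sum_def)
  have f11: "int (a n (m + 1) k) - int (a n m k) = - int (b (n - 1) m (k - 1))"
    if "3 \<le> n" "3 \<le> m + 2" "m + 2 \<le> k" "k \<le> n - 1" for n m k
  proof -
    have "{m..n - 1} = insert m {m + 1..n - 1}" using that by auto
    then show ?thesis using that by (simp add: ra)
  qed
  have f12: "int (a n (m + 1) k) - int (a n m k) = - int (b (n - 1) m k)"
    if "3 \<le> n" "2 \<le> k + 1" "k + 1 \<le> m" "m \<le> n - 1" for n m k
  proof -
    have "{m..n - 1} = insert m {m + 1..n - 1}" using that by auto
    then show ?thesis using that by (simp add: ra)
  qed
  have "twin_seidel a b"
    unfolding twin_seidel_def
    by (intro conjI allI impI; (elim conjE)?;
        ((rule f1 f2 f3[THEN conjunct1] f3[THEN conjunct2] f4[THEN conjunct1] f4[THEN conjunct2]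
          f5 f6 f7 f8 f9 f10 f11 f12; assumption) | simp add: a2 b2))
  then show ?thesis by blast
qed

lemma twin_seidelD:
  assumes "twin_seidel a b" "3 \<le> n"
  shows "1 \<le> m \<Longrightarrow> m \<le> n \<Longrightarrow> a n m m = 0"
    and "1 \<le> m \<Longrightarrow> m \<le> n \<Longrightarrow> b n m m = 0"
    and "1 \<le> m \<Longrightarrow> m \<le> n \<Longrightarrow> a n m n = 0"
    and "1 \<le> m \<Longrightarrow> m \<le> n \<Longrightarrow> b n m n = 0"
    and "1 \<le> k \<Longrightarrow> k \<le> n \<Longrightarrow> a n n k = 0"
    and "1 \<le> k \<Longrightarrow> k \<le> n \<Longrightarrow> b n 1 k = 0"
    and "b n n 1 = 0"
    and "2 \<le> k \<Longrightarrow> k \<le> n - 1 \<Longrightarrow> b n n k = col_sum (n - 1) (a (n - 1)) (k - 1)"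
    and "1 \<le> k \<Longrightarrow> k \<le> n - 2 \<Longrightarrow> b n (n - 1) k = col_sum (n - 1) (a (n - 1)) k"
    and "2 \<le> k + 1 \<Longrightarrow> k + 1 \<le> m \<Longrightarrow> m \<le> n - 2 \<Longrightarrow>
      int (b n (m + 1) k) - int (b n m k) = int (a (n - 1) m k)"
    and "3 \<le> m + 2 \<Longrightarrow> m + 2 \<le> k \<Longrightarrow> k \<le> n - 1 \<Longrightarrow>
      int (b n (m + 1) k) - int (b n m k) = int (a (n - 1) m (k - 1))"
    and "2 \<le> k \<Longrightarrow> k \<le> n - 1 \<Longrightarrow> a n 1 k = col_sum (n - 1) (b (n - 1)) (k - 1)"
    and "3 \<le> m + 2 \<Longrightarrow> m + 2 \<le> k \<Longrightarrow> k \<le> n - 1 \<Longrightarrow>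
      int (a n (m + 1) k) - int (a n m k) = - int (b (n - 1) m (k - 1))"
    and "2 \<le> k + 1 \<Longrightarrow> k + 1 \<le> m \<Longrightarrow> m \<le> n - 1 \<Longrightarrow>
      int (a n (m + 1) k) - int (a n m k) = - int (b (n - 1) m k)"
proof -
  have n: "2 \<le> n" "(n, m) \<noteq> (2, 1)" for m :: nat using assms(2) by auto
  note T = assms(1)[unfolded twin_seidel_def]
  show "1 \<le> m \<Longrightarrow> m \<le> n \<Longrightarrow> a n m m = 0"
    using T[THEN conjunct2, THEN conjunct1, rule_format] assms(2) n by blast
  show "1 \<le> m \<Longrightarrow> m \<le> n \<Longrightarrow> b n m m = 0"
    using T[THEN conjunct2, THEN conjunct2, THEN conjunct1, rule_format] assms(2) n by blast
  show "1 \<le> m \<Longrightarrow> m \<le> n \<Longrightarrow> a n m n = 0"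
    using T[THEN conjunct2, THEN conjunct2, THEN conjunct2, THEN conjunct1, rule_format] assms(2) n by blast
  show "1 \<le> m \<Longrightarrow> m \<le> n \<Longrightarrow> b n m n = 0"
    using T[THEN conjunct2, THEN conjunct2, THEN conjunct2, THEN conjunct1, rule_format] assms(2) n by blast
  show "1 \<le> k \<Longrightarrow> k \<le> n \<Longrightarrow> a n n k = 0"
    using T[THEN conjunct2, THEN conjunct2, THEN conjunct2, THEN conjunct2, THEN conjunct1, rule_format] assms(2) n by blast
  show "1 \<le> k \<Longrightarrow> k \<le> n \<Longrightarrow> b n 1 k = 0"
    using T[THEN conjunct2, THEN conjunct2, THEN conjunct2, THEN conjunct2, THEN conjunct1, rule_format] assms(2) n by blast
  show "b n n 1 = 0"
    using T[THEN conjunct2, THEN conjunct2, THEN conjunct2, THEN conjunct2, THEN conjunct2, THEN conjunct1, rule_format] assms(2) n by blast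
  show "2 \<le> k \<Longrightarrow> k \<le> n - 1 \<Longrightarrow> b n n k = col_sum (n - 1) (a (n - 1)) (k - 1)"
    using T[THEN conjunct2, THEN conjunct2, THEN conjunct2, THEN conjunct2, THEN conjunct2, THEN conjunct2, THEN conjunct2, THEN conjunct2, THEN conjunct1, rule_format] assms(2) n by blast
  show "1 \<le> k \<Longrightarrow> k \<le> n - 2 \<Longrightarrow> b n (n - 1) k = col_sum (n - 1) (a (n - 1)) k"
    using T[THEN conjunct2, THEN conjunct2, THEN conjunct2, THEN conjunct2, THEN conjunct2, THEN conjunct2, THEN conjunct2, THEN conjunct2, THEN conjunct2, THEN conjunct1, rule_format] assms(2) n by blast
  show "2 \<le> k + 1 \<Longrightarrow> k + 1 \<le> m \<Longrightarrow> m \<le> n - 2 \<Longrightarrow>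
      int (b n (m + 1) k) - int (b n m k) = int (a (n - 1) m k)"
    using T[THEN conjunct2, THEN conjunct2, THEN conjunct2, THEN conjunct2, THEN conjunct2, THEN conjunct2, THEN conjunct2, THEN conjunct2, THEN conjunct2, THEN conjunct2, THEN conjunct1, rule_format] assms(2) n by blast
  show "3 \<le> m + 2 \<Longrightarrow> m + 2 \<le> k \<Longrightarrow> k \<le> n - 1 \<Longrightarrow>
      int (b n (m + 1) k) - int (b n m k) = int (a (n - 1) m (k - 1))"
    using T[THEN conjunct2, THEN conjunct2, THEN conjunct2, THEN conjunct2, THEN conjunct2, THEN conjunct2, THEN conjunct2, THEN conjunct2, THEN conjunct2, THEN conjunct2, THEN conjunct2, THEN conjunct1, rule_format] assms(2) n by blast
  show "2 \<le> k \<Longrightarrow> k \<le> n - 1 \<Longrightarrow> a n 1 k = col_sum (n - 1) (b (n - 1)) (k - 1)"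
    using T[THEN conjunct2, THEN conjunct2, THEN conjunct2, THEN conjunct2, THEN conjunct2, THEN conjunct2, THEN conjunct2, THEN conjunct2, THEN conjunct2, THEN conjunct2, THEN conjunct2, THEN conjunct2, THEN conjunct1, rule_format] assms(2) n by blast
  show "3 \<le> m + 2 \<Longrightarrow> m + 2 \<le> k \<Longrightarrow> k \<le> n - 1 \<Longrightarrow>
      int (a n (m + 1) k) - int (a n m k) = - int (b (n - 1) m (k - 1))"
    using T[THEN conjunct2, THEN conjunct2, THEN conjunct2, THEN conjunct2, THEN conjunct2, THEN conjunct2, THEN conjunct2, THEN conjunct2, THEN conjunct2, THEN conjunct2, THEN conjunct2, THEN conjunct2, THEN conjunct2, THEN conjunct1, rule_format] assms(2) n by blast
  show "2 \<le> k + 1 \<Longrightarrow> k + 1 \<le> m \<Longrightarrow> m \<le> n - 1 \<Longrightarrow>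
      int (a n (m + 1) k) - int (a n m k) = - int (b (n - 1) m k)"
    using T[THEN conjunct2, THEN conjunct2, THEN conjunct2, THEN conjunct2, THEN conjunct2, THEN conjunct2, THEN conjunct2, THEN conjunct2, THEN conjunct2, THEN conjunct2, THEN conjunct2, THEN conjunct2, THEN conjunct2, THEN conjunct2, rule_format] assms(2) n by blast
qed

lemma twin_seidel_unique:
  assumes "twin_seidel a b" "twin_seidel a' b'"
  assumes "2 \<le> n" "m \<in> {1..n}" "k \<in> {1..n}"
  shows "a n m k = a' n m k \<and> b n m k = b' n m k"
  using \<open>2 \<le> n\<close> \<open>m \<in> {1..n}\<close> \<open>k \<in> {1..n}\<close>
proof (induction n arbitrary: m k rule: dec_induct)
  case base
  then have "m = 1 \<or> m = 2" "k = 1 \<or> k = 2" by auto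
  then show ?case using assms(1,2) unfolding twin_seidel_def by (elim disjE) simp_all
next
  case (step n)
  define N where "N = Suc n"
  have N: "3 \<le> N" "N - 1 = n" "m \<in> {1..N}" "k \<in> {1..N}" using step by (auto simp: N_def)
  have IH: "a (N - 1) i j = a' (N - 1) i j" "b (N - 1) i j = b' (N - 1) i j"
    if "1 \<le> i" "i \<le> N - 1" "1 \<le> j" "j \<le> N - 1" for i j
    using step.IH[of i j] that unfolding N(2) by auto
  have cs: "col_sum (N - 1) (a (N - 1)) j = col_sum (N - 1) (a' (N - 1)) j"
    "col_sum (N - 1) (b (N - 1)) j = col_sum (N - 1) (b' (N - 1)) j" if "1 \<le> j" "j \<le> N - 1" for j
    using that by (auto simp: col_sum_def simp del: One_nat_def intro!: sum.cong IH)
  note T = twin_seidelD[OF assms(1) N(1)] and T' = twin_seidelD[OF assms(2) N(1)]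
  have z: "a N i i = 0 \<and> b N i i = 0 \<and> a' N i i = 0 \<and> b' N i i = 0
      \<and> a N i N = 0 \<and> b N i N = 0 \<and> a' N i N = 0 \<and> b' N i N = 0
      \<and> a N N i = 0 \<and> b N 1 i = 0 \<and> a' N N i = 0 \<and> b' N 1 i = 0 \<and> b N N 1 = 0 \<and> b' N N 1 = 0"
    if "1 \<le> i" "i \<le> N" for i
    by (intro conjI T(1-6)[OF that] T'(1-6)[OF that] T(7) T'(7))
  have au: "a N i j = a' N i j" if "1 \<le> i" "i < j" "j \<le> N - 1" for i j
    using \<open>1 \<le> i\<close> \<open>i < j\<close>
  proof (induction i rule: dec_induct)
    case base
    then have "2 \<le> j" by simp
    then have "a N 1 j = col_sum (N - 1) (b (N - 1)) (j - 1)" "a' N 1 j = col_sum (N - 1) (b' (N - 1)) (j - 1)"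
      using T(12) T'(12) that(3) by blast+
    then show ?case using cs[of "j - 1"] \<open>2 \<le> j\<close> that(3) by auto
  next
    case (step i)
    have h: "3 \<le> i + 2" "i + 2 \<le> j" using step by auto
    have "int (a N (i + 1) j) - int (a N i j) = - int (b (N - 1) i (j - 1))"
      "int (a' N (i + 1) j) - int (a' N i j) = - int (b' (N - 1) i (j - 1))"
      using T(13) T'(13) that(3) h by blast+
    then show ?case using step h that IH(2)[of i "j - 1"] by auto
  qed
  have bu: "b N i j = b' N i j" if "1 \<le> i" "i < j" "j \<le> N - 1" for i j
    using \<open>1 \<le> i\<close> \<open>i < j\<close>
  proof (induction i rule: dec_induct)
    case base
    then show ?case using z[of j] that by auto
  next
    case (step i)
    have h: "3 \<le> i + 2" "i + 2 \<le> j" using step by auto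
    have "int (b N (i + 1) j) - int (b N i j) = int (a (N - 1) i (j - 1))"
      "int (b' N (i + 1) j) - int (b' N i j) = int (a' (N - 1) i (j - 1))"
      using T(11) T'(11) that(3) h by blast+
    then show ?case using step h that IH(1)[of i "j - 1"] by auto
  qed
  have al: "a N i j = a' N i j" if "1 \<le> j" "j < i" "i \<le> N" for i j
    using \<open>i \<le> N\<close> \<open>j < i\<close>
  proof (induction i rule: inc_induct)
    case base
    then show ?case using z[of j] that by auto
  next
    case (step i)
    have h: "2 \<le> j + 1" "j + 1 \<le> i" "i \<le> N - 1" using step that by auto
    have "int (a N (i + 1) j) - int (a N i j) = - int (b (N - 1) i j)"
      "int (a' N (i + 1) j) - int (a' N i j) = - int (b' (N - 1) i j)"
      using T(14) T'(14) h by blast+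
    then show ?case using step h that IH(2)[of i j] by auto
  qed
  have bl: "b N i j = b' N i j" if "1 \<le> j" "j < i" "i \<le> N - 1" for i j
    using \<open>i \<le> N - 1\<close> \<open>j < i\<close>
  proof (induction i rule: inc_induct)
    case base
    then have h: "j \<le> N - 2" by simp
    have "b N (N - 1) j = col_sum (N - 1) (a (N - 1)) j" "b' N (N - 1) j = col_sum (N - 1) (a' (N - 1)) j"
      using T(9) T'(9) h that(1) by blast+
    then show ?case using cs[of j] that by auto
  next
    case (step i)
    have h: "2 \<le> j + 1" "j + 1 \<le> i" "i \<le> N - 2" using step that by auto
    have "int (b N (i + 1) j) - int (b N i j) = int (a (N - 1) i j)"
      "int (b' N (i + 1) j) - int (b' N i j) = int (a' (N - 1) i j)"
      using T(10) T'(10) h by blast+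
    then show ?case using step h that IH(1)[of i j] by auto
  qed
  have bn: "b N N j = b' N N j" if "1 \<le> j" "j \<le> N - 1" for j
  proof (cases "j = 1")
    case True
    then show ?thesis using z[of j] N(1) by auto
  next
    case False
    then have h: "2 \<le> j" using that by simp
    then have "b N N j = col_sum (N - 1) (a (N - 1)) (j - 1)" "b' N N j = col_sum (N - 1) (a' (N - 1)) (j - 1)"
      using T(8) T'(8) that(2) by blast+
    then show ?thesis using cs[of "j - 1"] h that by auto
  qed
  consider "m = k" | "k = N" | "m < k" "k \<le> N - 1" | "k < m" "m \<le> N - 1" | "m = N" "k \<le> N - 1"
    using N by fastforce
  then have "a N m k = a' N m k \<and> b N m k = b' N m k"
    using N z[of m] au[of m k] bu[of m k] al[of k m] bl[of k m] bn[of k] by cases auto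
  then show ?case by (simp add: N_def)
qed

text \<open>
  Formal power series in \<open>x\<close>, \<open>y\<close>, \<open>z\<close> are iterated univariate ones: the coefficient of
  \<open>x\<^sup>i y\<^sup>j z\<^sup>l\<close> in \<open>F\<close> is \<open>F $ i $ j $ l\<close>.
\<close>

type_synonym fps3 = "rat fps fps fps"

definition X3 :: fps3 where "X3 = fps_X"
definition Y3 :: fps3 where "Y3 = fps_const fps_X"
definition Z3 :: fps3 where "Z3 = fps_const (fps_const fps_X)"

definition fps3_const :: "rat \<Rightarrow> fps3" where
  "fps3_const c = fps_const (fps_const (fps_const c))"

text \<open>
  Substitution \<open>f(S) = (\<Sum>r. f\<^sub>r S\<^sup>r)\<close>, for \<open>S\<close> without constant term: then \<open>S\<^sup>r\<close> contains only
  monomials of total degree at least \<open>r\<close>, whence the bound on \<open>r\<close>.  (The library's \<open>fps_compose\<close>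
  truncates by the degree in the outermost variable only and is not applicable to \<open>S = x + y + z\<close>.)
\<close>

definition fps3_compose :: "rat fps \<Rightarrow> fps3 \<Rightarrow> fps3" where
  "fps3_compose f S =
     Abs_fps (\<lambda>i. Abs_fps (\<lambda>j. Abs_fps (\<lambda>l. \<Sum>r\<le>i + j + l. f $ r * (S ^ r) $ i $ j $ l)))"

definition fps3_sin :: "fps3 \<Rightarrow> fps3" where
  "fps3_sin S = fps3_compose (fps_sin 1) S"

definition fps3_cos :: "fps3 \<Rightarrow> fps3" where
  "fps3_cos S = fps3_compose (fps_cos 1) S"

text \<open>
  Sum of a possibly infinite family of formal power series, each monomial occurring in only
  finitely many members of the family.
\<close>

definition fps3_has_sum :: "('i \<Rightarrow> fps3) \<Rightarrow> 'i set \<Rightarrow> fps3 \<Rightarrow> bool" where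
  "fps3_has_sum F I S \<longleftrightarrow>
     (\<forall>i j l. finite {t \<in> I. F t $ i $ j $ l \<noteq> 0} \<and>
              S $ i $ j $ l = (\<Sum>t \<in> {t \<in> I. F t $ i $ j $ l \<noteq> 0}. F t $ i $ j $ l))"

text \<open>
  The library division on iterated power series is the genuine one whenever the constant term
  of the divisor is nonzero.
\<close>

lemma fps3_divide:
  fixes F G :: fps3
  assumes "G $ 0 $ 0 $ 0 \<noteq> 0"
  shows "F / G * G = F"
proof -
  have unit: "inverse g * g = 1" if "inverse (g $ 0) * g $ 0 = 1" for g :: "'b :: {comm_ring_1, inverse} fps"
    using that fps_right_inverse[of g "inverse (g $ 0)"]
    by (simp add: fps_inverse_def mult.commute)
  have "inverse (G $ 0 $ 0) * G $ 0 $ 0 = 1" using assms by (simp add: inverse_mult_eq_1)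
  then have "inverse (G $ 0) * G $ 0 = 1" by (rule unit)
  then have 1: "inverse G * G = 1" by (rule unit)
  have "G $ 0 \<noteq> 0" using assms by auto
  then have "F / G = F * inverse G" by (rule fps_divide_unit)
  with 1 show ?thesis by (simp add: mult.assoc)
qed

lemma fps3_cos_const_nonzero: "fps3_cos S $ 0 $ 0 $ 0 \<noteq> 0"
  by (simp add: fps3_cos_def fps3_compose_def)

end

theory Submission
  imports Defs
begin

text \<open>
  Collect the entries of \<open>A\<^sub>2\<^sub>n\<close> and \<open>B\<^sub>2\<^sub>n\<^sub>+\<^sub>1\<close> above and below the diagonal into exponential
  generating functions \<open>A\<^sup>u, B\<^sup>u, A\<^sup>l, B\<^sup>l\<close>.  With \<open>D = \<partial>\<^sub>x - \<partial>\<^sub>y\<close> the difference equations read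
  \<open>D B\<^sup>u = A\<^sup>u\<close>, \<open>D A\<^sup>u = - B\<^sup>u\<close>, \<open>D A\<^sup>l = B\<^sup>l\<close>, \<open>D B\<^sup>l = - A\<^sup>l\<close>, and the boundary conditions
  become \<open>B\<^sup>u(0,y,z) = 0\<close>, \<open>A\<^sup>l(0,y,0) = 0\<close>, \<open>\<partial>\<^sub>z A\<^sup>l(0,y,z) = B\<^sup>l(0,y,z)\<close>,
  \<open>A\<^sup>u(x,0,z) = A\<^sup>l(z,0,x)\<close> and \<open>B\<^sup>l(x,0,z) = B\<^sup>u(z,0,x) + 1\<close>.
  These relations determine all coefficients, degree by degree, and they are satisfied, with
  \<open>s = x + y + z\<close>, by \<open>A\<^sup>u = cos x cos z sin s / cos\<^sup>2 s\<close>, \<open>B\<^sup>u = sin x cos z sin s / cos\<^sup>2 s\<close>,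
  \<open>A\<^sup>l = cos x sin z / cos s + sin x cos (x + y) / cos\<^sup>2 s\<close> and
  \<open>B\<^sup>l = - sin x sin z / cos s + cos x cos (x + y) / cos\<^sup>2 s\<close>, since \<open>D\<close> annihilates every
  function of \<open>x + y\<close> and \<open>z\<close>.
\<close>

section \<open>Trigonometric identities in an arbitrary commutative ring\<close>

text \<open>If (s, c) and (s', c') are the sine and cosine of two angles, the brackets are those of
  their sum. Subtracting the first angle recovers the second, as s * s + c * c factors out.\<close>

lemma angle_subtraction:
  fixes s c s' c' :: "'a :: comm_ring_1"
  assumes "s * s + c * c = 1"
  shows "c * (s * c' + c * s') - s * (c * c' - s * s') = s'"
    and "c * (c * c' - s * s') + s * (s * c' + c * s') = c'"
proof -
  have "c * (s * c' + c * s') - s * (c * c' - s * s') = (s * s + c * c) * s'"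
    "c * (c * c' - s * s') + s * (s * c' + c * s') = (s * s + c * c) * c'"
    by (simp_all add: algebra_simps)
  then show "c * (s * c' + c * s') - s * (c * c' - s * s') = s'"
    "c * (c * c' - s * s') + s * (s * c' + c * s') = c'"
    by (simp_all only: assms mult_1)
qed

text \<open>Here \<open>S\<close> and \<open>C\<close> are sin and cos of x + y + z expanded by the
  addition theorem, and \<open>T\<close> is 1 / cos(x + y + z). The first two identities compare the
  upper triangle series with the lower ones after exchanging x and z. Their error terms carry a
  factor \<open>sy\<close> or \<open>1 - cy\<close> and so vanish at y = 0. The third is cos(s - z)
  = cos(x + y).\<close>

lemma twin_series_ring_identities:
  fixes T :: "'a :: comm_ring_1"
  assumes x: "sx * sx + cx * cx = 1" and z: "sz * sz + cz * cz = 1"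
    and S: "S = sx * cy * cz + cx * sy * cz + cx * cy * sz - sx * sy * sz"
    and C: "C = cx * cy * cz - sx * sy * cz - sx * cy * sz - cx * sy * sz"
    and T: "T * C = 1"
  shows "cx * cz * S * T * T = cz * sx * T + sz * (cz * cy - sz * sy) * T * T + sy * (T * T)"
    and "sx * cz * S * T * T + 1 = cz * (cz * cy - sz * sy) * T * T - sz * sx * T
       + (1 - cy) * (T * (sx * sz - cx * cz)) + sy * (- (T * (sx * cz + cx * sz)))"
    and "cz * C + sz * S = cx * cy - sx * sy"
proof -
  \<comment> \<open>Regroup the angle as x + (y + z), so that x can be subtracted.\<close>
  have S': "S = sx * (cz * cy - sz * sy) + cx * (sz * cy + cz * sy)"
    and C': "C = cx * (cz * cy - sz * sy) - sx * (sz * cy + cz * sy)"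
    by (simp_all add: S C algebra_simps)
  have TT: "T = C * (T * T)" using T by (simp add: mult.assoc[symmetric] mult.commute)
  have 1: "cx * S = sx * C + (sz * cy + cz * sy)"
    using angle_subtraction(1)[OF x, of "cz * cy - sz * sy" "sz * cy + cz * sy"] unfolding S' C' by (simp add: algebra_simps)
  have 2: "sx * S = (cz * cy - sz * sy) - cx * C"
    using angle_subtraction(2)[OF x, of "cz * cy - sz * sy" "sz * cy + cz * sy"] unfolding S' C' by (simp add: algebra_simps)
  have 3: "cz * (sz * cy + cz * sy) = sz * (cz * cy - sz * sy) + sy"
    using angle_subtraction(1)[OF z, of cy sy] by (simp add: algebra_simps)
  have "cx * cz * S * T * T = cz * (cx * S) * (T * T)" by (simp add: mult_ac)
  also have "\<dots> = cz * sx * (C * (T * T)) + cz * (sz * cy + cz * sy) * (T * T)"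
    unfolding 1 by (simp add: algebra_simps)
  also have "\<dots> = cz * sx * T + sz * (cz * cy - sz * sy) * T * T + sy * (T * T)"
    unfolding 3 TT[symmetric] by (simp add: algebra_simps)
  finally show "cx * cz * S * T * T = cz * sx * T + sz * (cz * cy - sz * sy) * T * T + sy * (T * T)" .
  have "sx * cz * S * T * T + 1 = cz * (sx * S) * (T * T) + 1" by (simp add: mult_ac)
  \<comment> \<open>The summand 1 is rewritten as \<open>T * C\<close>; expanding this
    \<open>C\<close> yields the terms with \<open>cy\<close> and \<open>sy\<close> in the
    error.\<close>
  also have "\<dots> = cz * (cz * cy - sz * sy) * T * T - cx * cz * (C * (T * T)) + T * C"
    unfolding 2 T by (simp add: algebra_simps)
  also have "\<dots> = cz * (cz * cy - sz * sy) * T * T - sz * sx * T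
       + (1 - cy) * (T * (sx * sz - cx * cz)) + sy * (- (T * (sx * cz + cx * sz)))"
    unfolding TT[symmetric] unfolding C by (simp add: algebra_simps)
  finally show "sx * cz * S * T * T + 1 = cz * (cz * cy - sz * sy) * T * T - sz * sx * T
       + (1 - cy) * (T * (sx * sz - cx * cz)) + sy * (- (T * (sx * cz + cx * sz)))" .
  show "cz * C + sz * S = cx * cy - sx * sy"
    using angle_subtraction(2)[OF z, of "cx * cy - sx * sy" "sx * cy + cx * sy"] unfolding S C
    by (simp add: algebra_simps)
qed

subsection \<open>Trigonometric series in three variables\<close>

definition fps3_in_x :: "rat fps \<Rightarrow> fps3" where
  "fps3_in_x f = Abs_fps (\<lambda>i. fps_const (fps_const (f $ i)))"
definition fps3_in_y :: "rat fps \<Rightarrow> fps3" where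
  "fps3_in_y f = fps_const (Abs_fps (\<lambda>j. fps_const (f $ j)))"
definition fps3_in_z :: "rat fps \<Rightarrow> fps3" where
  "fps3_in_z f = fps_const (fps_const f)"

lemma fps3_eqI: "(\<And>i j l. F $ i $ j $ l = G $ i $ j $ l) \<Longrightarrow> F = (G :: fps3)"
  by (simp add: fps_eq_iff)

lemma fps3_in_xyz_nth:
  "(fps3_in_x f * fps3_in_y g * fps3_in_z h) $ i $ j $ l = f $ i * g $ j * h $ l"
  unfolding fps3_in_x_def fps3_in_y_def fps3_in_z_def
  by (simp add: mult.assoc)

lemma fps3_in_one [simp]: "fps3_in_x 1 = 1" "fps3_in_y 1 = 1" "fps3_in_z 1 = 1"
  by (rule fps3_eqI, simp add: fps3_in_x_def fps3_in_y_def fps3_in_z_def fps_one_def)+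

text \<open>The multinomial theorem, by induction on the exponent.\<close>

lemma linear_form_power_nth:
  "((fps3_const p * X3 + fps3_const q * Y3 + fps3_const t * Z3) ^ r) $ i $ j $ l =
     (if i + j + l = r then fact r / (fact i * fact j * fact l) * p ^ i * q ^ j * t ^ l else 0)"
proof (induction r arbitrary: i j l)
  case 0
  show ?case by simp
next
  case (Suc r)
  let ?S = "fps3_const p * X3 + fps3_const q * Y3 + fps3_const t * Z3"
  have x: "(fps3_const p * X3 * F) $ i $ j $ l = (if i = 0 then 0 else p * F $ (i - 1) $ j $ l)" for F
    by (simp add: fps3_const_def X3_def mult.assoc)
  have y: "(fps3_const q * Y3 * F) $ i $ j $ l = (if j = 0 then 0 else q * F $ i $ (j - 1) $ l)" for F
    by (simp add: fps3_const_def Y3_def mult.assoc)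
  have z: "(fps3_const t * Z3 * F) $ i $ j $ l = (if l = 0 then 0 else t * F $ i $ j $ (l - 1))" for F
    by (simp add: fps3_const_def Z3_def mult.assoc)
  \<comment> \<open>The expected coefficient divided by \<open>Suc r\<close>. The three ways to
    split off one variable contribute i, j and l times \<open>c\<close>, and i + j + l =
    \<open>Suc r\<close>.\<close>
  define c where "c = fact r / (fact i * fact j * fact l) * p ^ i * q ^ j * t ^ l"
  have 1: "(if i = 0 then 0 else p * (?S ^ r) $ (i - 1) $ j $ l) = (if i + j + l = Suc r then of_nat i * c else 0)"
    unfolding Suc.IH by (cases i) (auto simp: c_def divide_simps simp del: of_nat_Suc)
  have 2: "(if j = 0 then 0 else q * (?S ^ r) $ i $ (j - 1) $ l) = (if i + j + l = Suc r then of_nat j * c else 0)"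
    unfolding Suc.IH by (cases j) (auto simp: c_def divide_simps simp del: of_nat_Suc)
  have 3: "(if l = 0 then 0 else t * (?S ^ r) $ i $ j $ (l - 1)) = (if i + j + l = Suc r then of_nat l * c else 0)"
    unfolding Suc.IH by (cases l) (auto simp: c_def divide_simps simp del: of_nat_Suc)
  have "(?S ^ Suc r) $ i $ j $ l = (if i + j + l = Suc r then of_nat (i + j + l) * c else 0)"
    unfolding power_Suc distrib_right fps_add_nth x y z 1 2 3 of_nat_add by simp
  then show ?case by (auto simp: c_def field_simps)
qed

lemma fps3_compose_linear_nth:
  "fps3_compose f (fps3_const p * X3 + fps3_const q * Y3 + fps3_const t * Z3) $ i $ j $ l =
     f $ (i + j + l) * fact (i + j + l) / (fact i * fact j * fact l) * p ^ i * q ^ j * t ^ l"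
  by (simp add: fps3_compose_def linear_form_power_nth if_distrib[of "\<lambda>u. _ * u"] cong: if_cong)

lemma fps3_const_01 [simp]: "fps3_const 0 = 0" "fps3_const 1 = 1"
  by (simp_all add: fps3_const_def)

lemmas fps3_compose_nths =
  fps3_compose_linear_nth[where p = 1 and q = 0 and t = 0, simplified]
  fps3_compose_linear_nth[where p = 0 and q = 0 and t = 1, simplified]
  fps3_compose_linear_nth[where p = 1 and q = 1 and t = 0, simplified]
  fps3_compose_linear_nth[where p = 1 and q = 1 and t = 1, simplified]

lemma fps3_compose_X3: "fps3_compose f X3 = fps3_in_x f"
  by (rule fps3_eqI) (simp add: fps3_compose_nths fps3_in_x_def power_0_left)

lemma fps3_compose_Z3: "fps3_compose f Z3 = fps3_in_z f"
  by (rule fps3_eqI) (simp add: fps3_compose_nths fps3_in_z_def power_0_left)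

text \<open>The n-th derivatives of sin and cos at 0, that is sin(n pi / 2) and cos(n pi /
  2).\<close>

definition sin_sign :: "nat \<Rightarrow> rat" where "sin_sign n = fps_sin 1 $ n * fact n"
definition cos_sign :: "nat \<Rightarrow> rat" where "cos_sign n = fps_cos 1 $ n * fact n"

lemma sin_cos_sign_simps [simp]:
  "sin_sign 0 = 0" "cos_sign 0 = 1"
  "sin_sign (Suc n) = cos_sign n" "cos_sign (Suc n) = - sin_sign n"
proof -
  show "sin_sign 0 = 0" "cos_sign 0 = 1" by (simp_all add: sin_sign_def cos_sign_def)
  have "fps_cos 1 $ n = of_nat (n + 1) * fps_sin (1::rat) $ (n + 1)" "fps_sin 1 $ n = - (of_nat (n + 1) * fps_cos (1::rat) $ (n + 1))"
    unfolding fps_deriv_nth[symmetric] by (simp_all add: fps_sin_deriv fps_cos_deriv del: fps_deriv_nth)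
  then show "sin_sign (Suc n) = cos_sign n" "cos_sign (Suc n) = - sin_sign n"
    by (simp_all add: sin_sign_def cos_sign_def)
qed

text \<open>The addition theorem for multiples of pi / 2. Applied to exponents, it gives the
  addition theorem for the series coefficient by coefficient.\<close>

lemma sin_cos_sign_add:
  "sin_sign (m + n) = sin_sign m * cos_sign n + cos_sign m * sin_sign n"
  "cos_sign (m + n) = cos_sign m * cos_sign n - sin_sign m * sin_sign n"
  by (induction m) auto

lemma fps_sin_cos_nth:
  "fps_sin (1::rat) $ n = sin_sign n / fact n" "fps_cos (1::rat) $ n = cos_sign n / fact n"
  by (simp_all add: sin_sign_def cos_sign_def)

abbreviation "sx \<equiv> fps3_in_x (fps_sin 1)"
abbreviation "cx \<equiv> fps3_in_x (fps_cos 1)"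
abbreviation "sy \<equiv> fps3_in_y (fps_sin 1)"
abbreviation "cy \<equiv> fps3_in_y (fps_cos 1)"
abbreviation "sz \<equiv> fps3_in_z (fps_sin 1)"
abbreviation "cz \<equiv> fps3_in_z (fps_cos 1)"

lemma fps3_sin_XYZ:
  "fps3_sin (X3 + Y3 + Z3) = sx * cy * cz + cx * sy * cz + cx * cy * sz - sx * sy * sz"
  by (rule fps3_eqI, simp only: fps_add_nth fps_sub_nth fps3_in_xyz_nth fps3_sin_def fps3_compose_nths fps_sin_cos_nth sin_cos_sign_add)
     (simp add: field_simps)

lemma fps3_cos_XYZ:
  "fps3_cos (X3 + Y3 + Z3) = cx * cy * cz - sx * sy * cz - sx * cy * sz - cx * sy * sz"
  by (rule fps3_eqI, simp only: fps_add_nth fps_sub_nth fps3_in_xyz_nth fps3_cos_def fps3_compose_nths fps_sin_cos_nth sin_cos_sign_add)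
     (simp add: field_simps)

lemma fps3_cos_XY: "fps3_cos (X3 + Y3) = cx * cy - sx * sy"
proof -
  \<comment> \<open>The factor \<open>fps3_in_z 1\<close> is 1; it gives each product the shape
    required by \<open>fps3_in_xyz_nth\<close>.\<close>
  have "fps3_cos (X3 + Y3) = cx * cy * fps3_in_z 1 - sx * sy * fps3_in_z 1"
    by (rule fps3_eqI, simp only: fps_add_nth fps_sub_nth fps3_in_xyz_nth fps3_cos_def fps3_compose_nths fps_sin_cos_nth sin_cos_sign_add)
     (auto simp add: field_simps power_0_left fps_one_nth sin_cos_sign_add)
  then show ?thesis by simp
qed

subsection \<open>Partial derivatives and the exchange of x and z\<close>

definition dx :: "fps3 \<Rightarrow> fps3" where "dx = fps_deriv"
definition dy :: "fps3 \<Rightarrow> fps3" where "dy F = Abs_fps (\<lambda>i. fps_deriv (F $ i))"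
definition dz :: "fps3 \<Rightarrow> fps3" where "dz F = Abs_fps (\<lambda>i. Abs_fps (\<lambda>j. fps_deriv (F $ i $ j)))"

locale derivation =
  fixes d :: "'a :: comm_ring_1 \<Rightarrow> 'a"
  assumes add: "d (u + v) = d u + d v"
    and mult: "d (u * v) = d u * v + u * d v"
begin

lemma zero: "d 0 = 0" using add[of 0 0] by simp
lemma one: "d 1 = 0" using mult[of 1 1] by simp
lemma minus: "d (- u) = - d u" using add[of u "- u"] zero by (simp add: eq_neg_iff_add_eq_0 add.commute)
lemma diff: "d (u - v) = d u - d v" using add[of u "- v"] minus by simp
lemma sum: "d (sum f A) = (\<Sum>i\<in>A. d (f i))" by (induction A rule: infinite_finite_induct) (auto simp: zero add)

text \<open>Lifts a derivation of the coefficient ring to power series. One lift of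
  \<open>fps_deriv\<close> gives \<open>dy\<close>, two give \<open>dz\<close>.\<close>

lemma coeffwise: "derivation (\<lambda>F. Abs_fps (\<lambda>i. d (F $ i)))"
  by unfold_locales
     (auto intro!: fps_ext simp: add mult sum fps_mult_nth sum.distrib)

lemmas rules = add mult minus diff

lemma inverse_const:
  assumes "u * v = 1" "d v = 0"
  shows "d u = 0"
proof -
  have "d u * v = 0" using mult[of u v] assms one by simp
  then have "d u * (v * u) = 0" by (simp add: mult.assoc[symmetric])
  then show ?thesis using assms(1) by (simp add: mult.commute)
qed

end

lemma derivation_fps_deriv: "derivation (fps_deriv :: 'a :: comm_ring_1 fps \<Rightarrow> _)"
  by unfold_locales (auto simp: mult_ac add_ac)

interpretation dx: derivation dx unfolding dx_def by (rule derivation_fps_deriv)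
interpretation dy: derivation dy
  using derivation.coeffwise[OF derivation_fps_deriv] unfolding dy_def[abs_def] .
interpretation dz: derivation dz
  using derivation.coeffwise[OF derivation.coeffwise[OF derivation_fps_deriv]] unfolding dz_def[abs_def] by simp

definition dxy :: "fps3 \<Rightarrow> fps3" where "dxy F = dx F - dy F"

interpretation dxy: derivation dxy
  by unfold_locales (auto simp: dxy_def dx.rules dy.rules algebra_simps)

lemma dx_in [simp]:
  "dx (fps3_in_x f) = fps3_in_x (fps_deriv f)" "dx (fps3_in_y f) = 0" "dx (fps3_in_z f) = 0"
  by (rule fps3_eqI, simp add: dx_def fps3_in_x_def fps3_in_y_def fps3_in_z_def)+

lemma dy_in [simp]:
  "dy (fps3_in_x f) = 0" "dy (fps3_in_y f) = fps3_in_y (fps_deriv f)" "dy (fps3_in_z f) = 0"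
  by (rule fps3_eqI, simp add: dy_def fps3_in_x_def fps3_in_y_def fps3_in_z_def)+

lemma dxy_in [simp]:
  "dxy (fps3_in_x f) = fps3_in_x (fps_deriv f)" "dxy (fps3_in_y f) = - fps3_in_y (fps_deriv f)"
  "dxy (fps3_in_z f) = 0"
  by (simp_all add: dxy_def)

lemma dz_in [simp]:
  "dz (fps3_in_x f) = 0" "dz (fps3_in_y f) = 0" "dz (fps3_in_z f) = fps3_in_z (fps_deriv f)"
  by (rule fps3_eqI, simp add: dz_def fps3_in_x_def fps3_in_y_def fps3_in_z_def)+

lemma fps3_in_uminus [simp]:
  "fps3_in_x (- f) = - fps3_in_x f" "fps3_in_y (- f) = - fps3_in_y f" "fps3_in_z (- f) = - fps3_in_z f"
  by (rule fps3_eqI, simp add: fps3_in_x_def fps3_in_y_def fps3_in_z_def)+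

lemma trig_deriv [simp]:
  "fps_deriv (fps_sin (1::rat)) = fps_cos 1" "fps_deriv (fps_cos (1::rat)) = - fps_sin 1"
  by (simp_all add: fps_sin_deriv fps_cos_deriv fps_eq_iff)

definition fps3_swap :: "fps3 \<Rightarrow> fps3" where
  "fps3_swap F = Abs_fps (\<lambda>i. Abs_fps (\<lambda>j. Abs_fps (\<lambda>l. F $ l $ j $ i)))"

lemma fps3_swap_nth [simp]: "fps3_swap F $ i $ j $ l = F $ l $ j $ i"
  by (simp add: fps3_swap_def)

lemma fps3_mult_nth:
  "((F :: fps3) * G) $ i $ j $ l =
     (\<Sum>p=0..i. \<Sum>q=0..j. \<Sum>r=0..l. F $ p $ q $ r * G $ (i - p) $ (j - q) $ (l - r))"
  by (simp add: fps_mult_nth fps_sum_nth)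

lemma fps3_swap_ring_hom:
  "fps3_swap (F + G) = fps3_swap F + fps3_swap G"
  "fps3_swap (F - G) = fps3_swap F - fps3_swap G"
  "fps3_swap (- F) = - fps3_swap F"
  "fps3_swap 1 = 1"
  "fps3_swap (F * G) = fps3_swap F * fps3_swap G"
proof -
  show "fps3_swap (F + G) = fps3_swap F + fps3_swap G"
    "fps3_swap (F - G) = fps3_swap F - fps3_swap G"
    "fps3_swap (- F) = - fps3_swap F"
    by (rule fps3_eqI, simp)+
  show "fps3_swap 1 = 1" by (rule fps3_eqI) (simp add: fps_one_nth)
  show "fps3_swap (F * G) = fps3_swap F * fps3_swap G"
  proof (rule fps3_eqI)
    fix i j l
    have "fps3_swap (F * G) $ i $ j $ l =
        (\<Sum>p=0..l. \<Sum>q=0..j. \<Sum>r=0..i. F $ p $ q $ r * G $ (l - p) $ (j - q) $ (i - r))"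
      by (simp add: fps3_mult_nth)
    \<comment> \<open>Three exchanges of neighbouring sums reverse the nesting order p, q,
      r.\<close>
    also have "\<dots> = (\<Sum>p=0..l. \<Sum>r=0..i. \<Sum>q=0..j. F $ p $ q $ r * G $ (l - p) $ (j - q) $ (i - r))"
      by (rule sum.cong[OF refl], rule sum.swap)
    also have "\<dots> = (\<Sum>r=0..i. \<Sum>p=0..l. \<Sum>q=0..j. F $ p $ q $ r * G $ (l - p) $ (j - q) $ (i - r))"
      by (rule sum.swap)
    also have "\<dots> = (\<Sum>r=0..i. \<Sum>q=0..j. \<Sum>p=0..l. F $ p $ q $ r * G $ (l - p) $ (j - q) $ (i - r))"
      by (rule sum.cong[OF refl], rule sum.swap)
    also have "\<dots> = (fps3_swap F * fps3_swap G) $ i $ j $ l"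
      by (simp add: fps3_mult_nth)
    finally show "fps3_swap (F * G) $ i $ j $ l = (fps3_swap F * fps3_swap G) $ i $ j $ l" .
  qed
qed

lemma fps3_swap_in [simp]:
  "fps3_swap (fps3_in_x f) = fps3_in_z f" "fps3_swap (fps3_in_y f) = fps3_in_y f"
  "fps3_swap (fps3_in_z f) = fps3_in_x f"
  by (rule fps3_eqI, simp add: fps3_in_x_def fps3_in_y_def fps3_in_z_def)+

text \<open>With the factorials multiplied in, partial derivatives become plain index shifts, so
  differential equations turn into difference equations.\<close>

definition fps3_egf :: "fps3 \<Rightarrow> nat \<Rightarrow> nat \<Rightarrow> nat \<Rightarrow> rat" where
  "fps3_egf F i j l = F $ i $ j $ l * (fact i * fact j * fact l)"

lemma dx_nth: "dx F $ i $ j $ l = of_nat (Suc i) * F $ Suc i $ j $ l"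
  by (simp add: dx_def fps_of_nat[symmetric] algebra_simps)

lemma dy_nth: "dy F $ i $ j $ l = of_nat (Suc j) * F $ i $ Suc j $ l"
  by (simp add: dy_def fps_of_nat[symmetric] algebra_simps)

lemma dz_nth: "dz F $ i $ j $ l = of_nat (Suc l) * F $ i $ j $ Suc l"
  by (simp add: dz_def algebra_simps)

lemma fps3_egf_dxy:
  assumes "dxy F = G"
  shows "fps3_egf F (Suc i) j l = fps3_egf F i (Suc j) l + fps3_egf G i j l"
  using arg_cong[OF assms, of "\<lambda>H. H $ i $ j $ l * (fact i * fact j * fact l)"]
  by (simp add: fps3_egf_def dxy_def dx_nth dy_nth algebra_simps)

lemma fps3_pythagoras: "sx * sx + cx * cx = 1" "sz * sz + cz * cz = 1"
proof -
  show z: "sz * sz + cz * cz = 1"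
    using fps_sin_cos_sum_of_squares[of "1::rat"]
    by (simp add: fps3_in_z_def power2_eq_square add.commute)
  show "sx * sx + cx * cx = 1"
    using arg_cong[OF z, of fps3_swap] by (simp add: fps3_swap_ring_hom)
qed

text \<open>\<open>S\<close> and \<open>C\<close> depend only on x + y and z, so \<open>dxy\<close>
  kills them and also the inverse \<open>T\<close>. They are symmetric in x and z, and
  \<open>dz C = - S\<close> gives the derivative of \<open>T\<close> through the product rule for
  \<open>T * C = 1\<close>.\<close>

lemma cos_XYZ_inverse_relations:
  fixes S C T :: fps3
  defines "S \<equiv> sx * cy * cz + cx * sy * cz + cx * cy * sz - sx * sy * sz"
  defines "C \<equiv> cx * cy * cz - sx * sy * cz - sx * cy * sz - cx * sy * sz"
  assumes T: "T * C = 1"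
  shows "dxy T = 0" "dxy S = 0" "dz T = S * T * T" "fps3_swap S = S" "fps3_swap T = T"
proof -
  have DC: "dxy C = 0"
    by (simp add: C_def dxy.rules algebra_simps)
  then show "dxy T = 0" by (rule dxy.inverse_const[OF T])
  show "dxy S = 0"
    by (simp add: S_def dxy.rules algebra_simps)
  have "dz C = - S"
    by (simp add: C_def S_def dz.rules algebra_simps)
  then have "dz T * C = T * S" using dz.mult[of T C] T dz.one by simp
  have "dz T = (T * C) * dz T" by (simp add: T)
  also have "\<dots> = T * (dz T * C)" by (simp only: mult_ac)
  also have "\<dots> = S * T * T" unfolding \<open>dz T * C = T * S\<close> by (simp only: mult_ac)
  finally show "dz T = S * T * T" .
  show "fps3_swap S = S"
    by (simp add: S_def fps3_swap_ring_hom algebra_simps)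
  have swap_C: "fps3_swap C = C"
    by (simp add: C_def fps3_swap_ring_hom algebra_simps)
  have "fps3_swap T * C = 1"
    using arg_cong[OF T, of fps3_swap] by (simp add: fps3_swap_ring_hom swap_C)
  \<comment> \<open>Uniqueness of inverses: \<open>T\<close> and \<open>fps3_swap T\<close> both
    invert \<open>C\<close>.\<close>
  have "fps3_swap T = fps3_swap T * (T * C)" by (simp add: T)
  also have "\<dots> = T * (fps3_swap T * C)" by (simp only: mult_ac)
  finally show "fps3_swap T = T" by (simp add: \<open>fps3_swap T * C = 1\<close>)
qed

text \<open>The sine of a variable vanishes where that variable is 0. Boundary conditions are later
  checked by exhibiting such a factor.\<close>

lemma fps3_egf_0 [simp]:
  "fps3_egf (sx * F) 0 j l = 0" "fps3_egf (sy * F) i 0 l = 0" "fps3_egf (sz * F) i j 0 = 0"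
  by (simp_all add: fps3_egf_def fps3_in_x_def fps3_in_y_def fps3_in_z_def)

lemma fps3_egf_add: "fps3_egf (F + G) i j l = fps3_egf F i j l + fps3_egf G i j l"
  by (simp add: fps3_egf_def algebra_simps)

lemma fps3_egf_dz: "fps3_egf (dz F) i j l = fps3_egf F i j (Suc l)"
  by (simp add: fps3_egf_def dz_nth algebra_simps)

lemma fps3_egf_swap: "fps3_egf (fps3_swap F) i j l = fps3_egf F l j i"
  by (simp add: fps3_egf_def algebra_simps)

lemma fps3_egf_one: "fps3_egf 1 i j l = (if i = 0 \<and> j = 0 \<and> l = 0 then 1 else 0)"
  by (simp add: fps3_egf_def fps_one_nth)

subsection \<open>The recursion for triangular arrays\<close>

text \<open>
  The boundary conditions of (TS4), (TS5) involve column sums; these telescope by the difference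
  equations, and what remains is the symmetry relation between the two triangles next to the diagonal.
  The exceptional \<open>1\<close> comes from \<open>a\<^sub>2(1,1)\<close>.
\<close>

definition seidel_relations ::
  "(nat \<Rightarrow> nat \<Rightarrow> nat \<Rightarrow> rat) \<Rightarrow> (nat \<Rightarrow> nat \<Rightarrow> nat \<Rightarrow> rat) \<Rightarrow>
   (nat \<Rightarrow> nat \<Rightarrow> nat \<Rightarrow> rat) \<Rightarrow> (nat \<Rightarrow> nat \<Rightarrow> nat \<Rightarrow> rat) \<Rightarrow> bool" where
  "seidel_relations au bu al bl \<longleftrightarrow>
     (\<forall>i j l. au (Suc i) j l = au i (Suc j) l - bu i j l) \<and>
     (\<forall>i j l. bu (Suc i) j l = bu i (Suc j) l + au i j l) \<and>
     (\<forall>i j l. al (Suc i) j l = al i (Suc j) l + bl i j l) \<and>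
     (\<forall>i j l. bl (Suc i) j l = bl i (Suc j) l - al i j l) \<and>
     (\<forall>j l. bu 0 j l = 0) \<and>
     (\<forall>j. al 0 j 0 = 0) \<and>
     (\<forall>j l. al 0 j (Suc l) = bl 0 j l) \<and>
     (\<forall>i l. au i 0 l = al l 0 i) \<and>
     (\<forall>i l. bl i 0 l = bu l 0 i + (if i = 0 \<and> l = 0 then 1 else 0))"

text \<open>Induction on the total degree d. Within degree d the arrays are settled in the order
  \<open>bu\<close>, \<open>bl\<close>, \<open>al\<close>, \<open>au\<close>: \<open>bu\<close>
  starts from x-degree 0, \<open>bl\<close> from \<open>bu\<close> at y-degree 0, \<open>al\<close>
  from x-degree 0 using \<open>bl\<close> in degree d - 1, and \<open>au\<close> from
  \<open>al\<close> at y-degree 0. The difference equations then involve only known entries.\<close>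

lemma seidel_relations_unique:
  assumes "seidel_relations au bu al bl" "seidel_relations au' bu' al' bl'"
  shows "au i j l = au' i j l \<and> bu i j l = bu' i j l \<and> al i j l = al' i j l \<and> bl i j l = bl' i j l"
proof (induction "i + j + l" arbitrary: i j l rule: less_induct)
  case less
  define d where "d = i + j + l"
  note R = assms[unfolded seidel_relations_def]
  have IH: "au p q r = au' p q r" "bu p q r = bu' p q r" "al p q r = al' p q r" "bl p q r = bl' p q r"
    if "p + q + r < d" for p q r
    using less[of p q r] that by (simp_all add: d_def)
  have bu: "bu p q r = bu' p q r" if "p + q + r = d" for p q r
    using that
  proof (induction p arbitrary: q)
    case 0
    then show ?case using R by simp
  next
    case (Suc p)
    then show ?case using R Suc.IH[of "Suc q"] IH(1)[of p q r] by simp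
  qed
  have bl: "bl p q r = bl' p q r" if "p + q + r = d" for p q r
    using that
  proof (induction q arbitrary: p)
    case 0
    then show ?case using R bu[of r 0 p] by (simp add: add.commute)
  next
    case (Suc q)
    \<comment> \<open>The known boundary is q = 0, so the recursion is solved for the entry with
      larger q.\<close>
    have "bl p (Suc q) r = bl (Suc p) q r + al p q r" "bl' p (Suc q) r = bl' (Suc p) q r + al' p q r"
      using R by simp_all
    then show ?case using Suc.IH[of "Suc p"] IH(3)[of p q r] Suc.prems by simp
  qed
  have al: "al p q r = al' p q r" if "p + q + r = d" for p q r
    using that
  proof (induction p arbitrary: q)
    case 0
    then show ?case using R IH(4)[of 0 q "r - 1"] by (cases r) simp_all
  next
    case (Suc p)
    then show ?case using R Suc.IH[of "Suc q"] IH(4)[of p q r] by simp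
  qed
  have au: "au p q r = au' p q r" if "p + q + r = d" for p q r
    using that
  proof (induction q arbitrary: p)
    case 0
    then show ?case using R al[of r 0 p] by (simp add: add.commute)
  next
    case (Suc q)
    have "au p (Suc q) r = au (Suc p) q r + bu p q r" "au' p (Suc q) r = au' (Suc p) q r + bu' p q r"
      using R by simp_all
    then show ?case using Suc.IH[of "Suc p"] IH(2)[of p q r] Suc.prems by simp
  qed
  show ?case using au bu al bl by (simp add: d_def)
qed

text \<open>
  Entry \<open>(m, k)\<close> of the matrix of size \<open>n = i + j + l + 3\<close>, where
  \<open>(i, j, l) = (m - 1, k - m - 1, n - 1 - k)\<close> above the diagonal and
  \<open>(i, j, l) = (n - 1 - m, m - k - 1, k - 1)\<close> below it.  The recursion links only
  \<open>A\<^sub>n\<close> with \<open>n\<close> even to \<open>B\<^sub>n\<close> with \<open>n\<close> odd, hence the parity filter \<open>P\<close>.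
\<close>

definition upper_entries :: "(nat \<Rightarrow> bool) \<Rightarrow> (nat \<Rightarrow> nat \<Rightarrow> nat \<Rightarrow> nat) \<Rightarrow> nat \<Rightarrow> nat \<Rightarrow> nat \<Rightarrow> rat" where
  "upper_entries P c i j l = (if P (i + j + l) then of_nat (c (Suc (Suc (Suc (i + j + l)))) (Suc i) (Suc (Suc (i + j)))) else 0)"

definition lower_entries :: "(nat \<Rightarrow> bool) \<Rightarrow> (nat \<Rightarrow> nat \<Rightarrow> nat \<Rightarrow> nat) \<Rightarrow> nat \<Rightarrow> nat \<Rightarrow> nat \<Rightarrow> rat" where
  "lower_entries P c i j l = (if P (i + j + l) then of_nat (c (Suc (Suc (Suc (i + j + l)))) (Suc (Suc (j + l))) (Suc l)) else 0)"

section \<open>Boundary relations extracted from the twin Seidel recursion\<close>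

text \<open>Column k of \<open>b (n - 1)\<close> is split at its zero diagonal entry. Above it the
  entries are differences in column k + 1 of \<open>a n\<close>, below it differences in column k.
  After telescoping, the total cancels against \<open>a n 1 (k + 1)\<close>, and
  \<open>a n n k\<close> is 0.\<close>

lemma twin_seidel_a_adjacent:
  assumes T: "twin_seidel a b" and n: "4 \<le> n" and k: "1 \<le> k" "k \<le> n - 2"
  shows "a n k (k + 1) = a n (k + 1) k"
proof -
  have n3: "3 \<le> n" "3 \<le> n - 1" using n by auto
  note t = twin_seidelD[OF T n3(1)]
  have "{1..n - 1} = {1..<k} \<union> ({k} \<union> {k + 1..<n})" using k n by auto
  then have "int (\<Sum>m = 1..n - 1. b (n - 1) m k) =
      (\<Sum>m = 1..<k. int (b (n - 1) m k)) + (int (b (n - 1) k k) + (\<Sum>m = k + 1..<n. int (b (n - 1) m k)))"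
    by (simp add: sum.union_disjoint del: One_nat_def)
  also have "(\<Sum>m = 1..<k. int (b (n - 1) m k)) = - (\<Sum>m = 1..<k. int (a n (Suc m) (k + 1)) - int (a n m (k + 1)))"
    unfolding sum_negf[symmetric]
  proof (rule sum.cong[OF refl])
    fix m assume "m \<in> {1..<k}"
    then show "int (b (n - 1) m k) = - (int (a n (Suc m) (k + 1)) - int (a n m (k + 1)))"
      using t(13)[of m "k + 1"] k n by auto
  qed
  also have "\<dots> = int (a n 1 (k + 1)) - int (a n k (k + 1))"
    using k by (subst sum_Suc_diff') auto
  also have "int (b (n - 1) k k) = 0" using twin_seidelD(2)[OF T n3(2), of k] k by simp
  also have "(\<Sum>m = k + 1..<n. int (b (n - 1) m k)) = - (\<Sum>m = k + 1..<n. int (a n (Suc m) k) - int (a n m k))"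
    unfolding sum_negf[symmetric]
  proof (rule sum.cong[OF refl])
    fix m assume "m \<in> {k + 1..<n}"
    then have "k + 1 \<le> m" "m \<le> n - 1" by auto
    then show "int (b (n - 1) m k) = - (int (a n (Suc m) k) - int (a n m k))"
      using t(14)[of k m] k by simp
  qed
  also have "\<dots> = int (a n (k + 1) k) - int (a n n k)"
    using k by (subst sum_Suc_diff') auto
  finally have "int (\<Sum>m = 1..n - 1. b (n - 1) m k) = int (a n 1 (k + 1)) - int (a n k (k + 1)) + int (a n (k + 1) k)"
    using t(5)[of k] k by simp
  moreover have "a n 1 (k + 1) = (\<Sum>m = 1..n - 1. b (n - 1) m k)"
    using t(12)[of "k + 1"] k by (simp add: col_sum_def)
  ultimately show ?thesis by simp
qed

text \<open>The same telescoping for column k of \<open>a (n - 1)\<close>, whose sum is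
  \<open>b n (n - 1) k\<close>. The bound on n keeps \<open>a 2 1 1 = 1\<close> off the diagonal
  that is used.\<close>

lemma twin_seidel_b_adjacent:
  assumes T: "twin_seidel a b" and n: "4 \<le> n" and k: "1 \<le> k" "k \<le> n - 2"
  shows "b n k (k + 1) = b n (k + 1) k"
proof -
  have n3: "3 \<le> n" "3 \<le> n - 1" using n by auto
  note t = twin_seidelD[OF T n3(1)]
  \<comment> \<open>The last row is split off because the difference rule below the diagonal ends at
    row n - 2; its entry is 0.\<close>
  have "{1..n - 1} = {1..<k} \<union> ({k} \<union> ({k + 1..<n - 1} \<union> {n - 1}))"
    "{1..<k} \<inter> ({k} \<union> ({k + 1..<n - 1} \<union> {n - 1})) = {}" "{k} \<inter> ({k + 1..<n - 1} \<union> {n - 1}) = {}"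
    "{k + 1..<n - 1} \<inter> {n - 1} = {}"
    using k n by auto
  then have "int (\<Sum>m = 1..n - 1. a (n - 1) m k) =
      (\<Sum>m = 1..<k. int (a (n - 1) m k)) + (int (a (n - 1) k k) + ((\<Sum>m = k + 1..<n - 1. int (a (n - 1) m k)) + int (a (n - 1) (n - 1) k)))"
    by (simp only: sum.union_disjoint finite_Un finite_insert finite.emptyI finite_atLeastLessThan of_nat_sum) simp
  also have "(\<Sum>m = 1..<k. int (a (n - 1) m k)) = (\<Sum>m = 1..<k. int (b n (Suc m) (k + 1)) - int (b n m (k + 1)))"
  proof (rule sum.cong[OF refl])
    fix m assume "m \<in> {1..<k}"
    then show "int (a (n - 1) m k) = int (b n (Suc m) (k + 1)) - int (b n m (k + 1))"
      using t(11)[of m "k + 1"] k n by auto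
  qed
  also have "\<dots> = int (b n k (k + 1)) - int (b n 1 (k + 1))"
    using k by (subst sum_Suc_diff') auto
  also have "int (a (n - 1) k k) = 0" using twin_seidelD(1)[OF T n3(2), of k] k by simp
  also have "int (a (n - 1) (n - 1) k) = 0" using twin_seidelD(5)[OF T n3(2), of k] k by simp
  also have "(\<Sum>m = k + 1..<n - 1. int (a (n - 1) m k)) = (\<Sum>m = k + 1..<n - 1. int (b n (Suc m) k) - int (b n m k))"
  proof (rule sum.cong[OF refl])
    fix m assume "m \<in> {k + 1..<n - 1}"
    then show "int (a (n - 1) m k) = int (b n (Suc m) k) - int (b n m k)"
      using t(10)[of k m] k n by auto
  qed
  also have "\<dots> = int (b n (n - 1) k) - int (b n (k + 1) k)"
    using k by (subst sum_Suc_diff') auto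
  finally have "int (\<Sum>m = 1..n - 1. a (n - 1) m k) = int (b n k (k + 1)) + int (b n (n - 1) k) - int (b n (k + 1) k)"
    using t(6)[of "k + 1"] k by simp
  moreover have "b n (n - 1) k = (\<Sum>m = 1..n - 1. a (n - 1) m k)"
    using t(9)[of k] k by (simp add: col_sum_def)
  ultimately show ?thesis by simp
qed

text \<open>Row n of \<open>a n\<close> is 0, so the last difference equates row n - 1 of
  \<open>a n\<close> with row n - 1 of \<open>b (n - 1)\<close>. That row and row n - 2 of
  \<open>b (n - 1)\<close> list the same column sums, shifted by one column.\<close>

lemma twin_seidel_last_row:
  assumes T: "twin_seidel a b" and n: "4 \<le> n"
  shows "a n (n - 1) 1 = 0" and "1 \<le> k \<Longrightarrow> k \<le> n - 3 \<Longrightarrow> a n (n - 1) (k + 1) = b (n - 1) (n - 2) k"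
proof -
  have n3: "3 \<le> n" "3 \<le> n - 1" using n by auto
  have *: "a n (n - 1) k = b (n - 1) (n - 1) k" if "1 \<le> k" "k \<le> n - 2" for k
    using twin_seidelD(14)[OF T n3(1), of k "n - 1"] twin_seidelD(5)[OF T n3(1), of k] that by simp
  show "a n (n - 1) 1 = 0" using *[of 1] twin_seidelD(7)[OF T n3(2)] n by simp
  show "a n (n - 1) (k + 1) = b (n - 1) (n - 2) k" if k: "1 \<le> k" "k \<le> n - 3"
    using *[of "k + 1"] twin_seidelD(8)[OF T n3(2), of "k + 1"] twin_seidelD(9)[OF T n3(2), of k] k
    by (simp add: numeral_eq_Suc)
qed

lemma twin_seidel_relations:
  assumes T: "twin_seidel a b"
  shows "seidel_relations (upper_entries odd a) (upper_entries even b)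
           (lower_entries odd a) (lower_entries even b)"
  unfolding seidel_relations_def
proof (intro conjI allI)
  have of_int_eq: "(of_nat u :: rat) - of_nat v = of_nat w" if "int u - int v = int w" for u v w
    using that by (metis of_int_diff of_int_of_nat_eq)
  have of_int_eq': "(of_nat u :: rat) - of_nat v = - of_nat w" if "int u - int v = - int w" for u v w
    using that by (metis of_int_diff of_int_of_nat_eq of_int_minus)
  fix i j l :: nat
  \<comment> \<open>Degree i + j + l + 1 corresponds to size i + j + l + 4, and the recursion refers
    back to size i + j + l + 3. For one parity of i + j + l all terms are filtered out, for the
    other it is the matrix recursion.\<close>
  show "upper_entries odd a (Suc i) j l = upper_entries odd a i (Suc j) l - upper_entries even b i j l"
    using of_int_eq'[OF twin_seidelD(13)[OF T, of "Suc (Suc (Suc (Suc (i + j + l))))" "Suc i" "Suc (Suc (Suc (i + j)))"]]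
    by (cases "even (i + j + l)") (simp_all add: upper_entries_def algebra_simps del: even_add odd_add)
  show "upper_entries even b (Suc i) j l = upper_entries even b i (Suc j) l + upper_entries odd a i j l"
    using of_int_eq[OF twin_seidelD(11)[OF T, of "Suc (Suc (Suc (Suc (i + j + l))))" "Suc i" "Suc (Suc (Suc (i + j)))"]]
    by (cases "even (i + j + l)") (simp_all add: upper_entries_def algebra_simps del: even_add odd_add)
  show "lower_entries odd a (Suc i) j l = lower_entries odd a i (Suc j) l + lower_entries even b i j l"
    using of_int_eq'[OF twin_seidelD(14)[OF T, of "Suc (Suc (Suc (Suc (i + j + l))))" "Suc l" "Suc (Suc (j + l))"]]
    by (cases "even (i + j + l)") (simp_all add: lower_entries_def algebra_simps del: even_add odd_add)
  show "lower_entries even b (Suc i) j l = lower_entries even b i (Suc j) l - lower_entries odd a i j l"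
    using of_int_eq[OF twin_seidelD(10)[OF T, of "Suc (Suc (Suc (Suc (i + j + l))))" "Suc l" "Suc (Suc (j + l))"]]
    by (cases "even (i + j + l)") (simp_all add: lower_entries_def algebra_simps del: even_add odd_add)
  show "upper_entries even b 0 j l = 0"
    using twin_seidelD(6)[OF T, of "Suc (Suc (Suc (j + l)))" "Suc (Suc j)"] by (simp add: upper_entries_def)
  \<comment> \<open>An odd j is positive, so the size j + 3 is at least 4.\<close>
  show "lower_entries odd a 0 j 0 = 0"
    using twin_seidel_last_row(1)[OF T, of "Suc (Suc (Suc j))"]
    by (auto simp: lower_entries_def dest: odd_pos)
  show "lower_entries odd a 0 j (Suc l) = lower_entries even b 0 j l"
    using twin_seidel_last_row(2)[OF T, of "Suc (Suc (Suc (Suc (j + l))))" "Suc l"]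
    by (simp add: lower_entries_def)
  show "upper_entries odd a i 0 l = lower_entries odd a l 0 i"
    using twin_seidel_a_adjacent[OF T, of "Suc (Suc (Suc (i + l)))" "Suc i"] odd_pos[of "i + l"]
    by (auto simp: lower_entries_def upper_entries_def add.commute add.left_commute)
  show "lower_entries even b i 0 l = upper_entries even b l 0 i + (if i = 0 \<and> l = 0 then 1 else 0)"
  proof (cases "i + l = 0")
    \<comment> \<open>Size 3: \<open>b 3 2 1\<close> is the first column sum of \<open>a 2\<close>,
      namely 1, while \<open>b 3 1 2\<close> is 0.\<close>
    case True
    then show ?thesis
      using twin_seidelD(9)[OF T, of 3 1] twin_seidelD(6)[OF T, of 3 2] T[unfolded twin_seidel_def]
      by (simp add: lower_entries_def upper_entries_def col_sum_def numeral_eq_Suc)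
  next
    case False
    then show ?thesis
      using twin_seidel_b_adjacent[OF T, of "Suc (Suc (Suc (i + l)))" "Suc l"]
      by (auto simp: lower_entries_def upper_entries_def add.commute add.left_commute)
  qed
qed

lemma fps3_egf_minus: "fps3_egf (- F) i j l = - fps3_egf F i j l"
  by (simp add: fps3_egf_def)

lemma fps3_egf_one_minus_cy: "fps3_egf ((1 - cy) * F) i 0 l = 0"
proof -
  have "1 - cy = fps3_in_y (1 - fps_cos 1)"
    by (rule fps3_eqI) (simp add: fps3_in_y_def fps_one_nth)
  then show ?thesis by (simp add: fps3_egf_def fps3_in_y_def)
qed

subsection \<open>The generating functions\<close>

text \<open>The difference equations hold because \<open>dxy\<close> treats \<open>S\<close>,
  \<open>T\<close> and cos(x + y) as constants and turns sin x into cos x and cos x into - sin x.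
  The boundary conditions hold up to multiples of series that vanish there.\<close>

lemma trig_seidel_relations:
  fixes S C T :: fps3
  defines "S \<equiv> sx * cy * cz + cx * sy * cz + cx * cy * sz - sx * sy * sz"
  defines "C \<equiv> cx * cy * cz - sx * sy * cz - sx * cy * sz - cx * sy * sz"
  assumes T: "T * C = 1"
  shows "seidel_relations
    (fps3_egf (cx * cz * S * T * T)) (fps3_egf (sx * cz * S * T * T))
    (fps3_egf (cx * sz * T + sx * (cx * cy - sx * sy) * T * T))
    (fps3_egf (cx * (cx * cy - sx * sy) * T * T - sx * sz * T))"
    (is "seidel_relations (fps3_egf ?Au) (fps3_egf ?Bu) (fps3_egf ?Al) (fps3_egf ?Bl)")
proof -
  note rel = cos_XYZ_inverse_relations[OF T[unfolded C_def], folded S_def]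
  note ring = twin_series_ring_identities[OF fps3_pythagoras S_def[THEN meta_eq_to_obj_eq] C_def[THEN meta_eq_to_obj_eq] T]
  have deriv: "dxy ?Au = - ?Bu" "dxy ?Bu = ?Au" "dxy ?Al = ?Bl" "dxy ?Bl = - ?Al"
    by (simp_all add: dxy.rules rel(1,2) algebra_simps)
  have swap_l: "?Au = fps3_swap ?Al + sy * (T * T)"
    unfolding fps3_swap_ring_hom fps3_swap_in rel(5) by (rule ring(1))
  have swap_b: "?Bu + 1 = fps3_swap ?Bl + (1 - cy) * (T * (sx * sz - cx * cz)) + sy * (- (T * (sx * cz + cx * sz)))"
    unfolding fps3_swap_ring_hom fps3_swap_in rel(5) by (rule ring(2))
  have TT: "T = C * (T * T)" using T by (simp add: mult.assoc[symmetric] mult.commute)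
  have "cx * (cz * T + sz * (S * T * T)) = cx * ((cz * C + sz * S) * T * T)"
    by (subst TT) (simp add: algebra_simps)
  then have "cx * (cz * T + sz * (S * T * T)) = cx * (cx * cy - sx * sy) * T * T"
    unfolding ring(3) by (simp only: mult.assoc)
  moreover have "dz ?Al = cx * (cz * T + sz * (S * T * T)) + sx * dz ((cx * cy - sx * sy) * T * T)"
    unfolding dz.add mult.assoc[of sx] mult.assoc[of cx] dz.mult[of sx] dz.mult[of cx] dz.mult[of sz]
    by (simp add: rel(3))
  \<comment> \<open>The derivative in the last bracket can stay unevaluated: its factor
    \<open>sx\<close> removes it at x = 0.\<close>
  ultimately have dz_l: "dz ?Al = ?Bl + sx * (sz * T + dz ((cx * cy - sx * sy) * T * T))"
    by (simp add: algebra_simps)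
  show ?thesis
    unfolding seidel_relations_def
  proof (intro conjI allI)
    fix i j l
    show "fps3_egf ?Au (Suc i) j l = fps3_egf ?Au i (Suc j) l - fps3_egf ?Bu i j l"
      "fps3_egf ?Bu (Suc i) j l = fps3_egf ?Bu i (Suc j) l + fps3_egf ?Au i j l"
      "fps3_egf ?Al (Suc i) j l = fps3_egf ?Al i (Suc j) l + fps3_egf ?Bl i j l"
      "fps3_egf ?Bl (Suc i) j l = fps3_egf ?Bl i (Suc j) l - fps3_egf ?Al i j l"
      using deriv[THEN fps3_egf_dxy, of i j l] unfolding fps3_egf_minus by simp_all
    show "fps3_egf ?Bu 0 j l = 0" unfolding mult.assoc[of sx] by simp
    have "?Al = sz * (cx * T) + sx * ((cx * cy - sx * sy) * T * T)" by (simp add: mult_ac)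
    then show "fps3_egf ?Al 0 j 0 = 0" by (simp only: fps3_egf_add fps3_egf_0)
    show "fps3_egf ?Al 0 j (Suc l) = fps3_egf ?Bl 0 j l"
      unfolding fps3_egf_dz[symmetric] dz_l fps3_egf_add by simp
    show "fps3_egf ?Au i 0 l = fps3_egf ?Al l 0 i"
      unfolding swap_l fps3_egf_add fps3_egf_swap by simp
    have "fps3_egf (?Bu + 1) l 0 i = fps3_egf ?Bl i 0 l"
      unfolding swap_b fps3_egf_add fps3_egf_swap fps3_egf_one_minus_cy fps3_egf_0 by simp
    then show "fps3_egf ?Bl i 0 l = fps3_egf ?Bu l 0 i + (if i = 0 \<and> l = 0 then 1 else 0)"
      by (auto simp: fps3_egf_add fps3_egf_one)
  qed
qed

section \<open>From coefficients to the two summation formulas\<close>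

lemma fps3_monomial_nth:
  "(fps3_const c * X3 ^ p * Y3 ^ q * Z3 ^ r) $ i $ j $ l = (if p = i \<and> q = j \<and> r = l then c else 0)"
  by (simp add: fps3_const_def X3_def Y3_def Z3_def mult.assoc fps_X_power_nth)

text \<open>Distinct members have distinct exponents, so each coefficient receives at most one
  contribution; exponents that do not occur are covered by the last hypothesis.\<close>

lemma fps3_has_sum_monomials:
  assumes inj: "inj_on (\<lambda>t. (p t, q t, r t)) I"
    and coeff: "\<And>t. t \<in> I \<Longrightarrow> S $ p t $ q t $ r t = c t"
    and zero: "\<And>i j l. (i, j, l) \<notin> (\<lambda>t. (p t, q t, r t)) ` I \<Longrightarrow> S $ i $ j $ l = 0"
  shows "fps3_has_sum (\<lambda>t. fps3_const (c t) * X3 ^ p t * Y3 ^ q t * Z3 ^ r t) I S"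
  unfolding fps3_has_sum_def fps3_monomial_nth
proof (intro allI)
  fix i j l
  let ?f = "\<lambda>t. if p t = i \<and> q t = j \<and> r t = l then c t else 0"
  show "finite {t \<in> I. ?f t \<noteq> 0} \<and> S $ i $ j $ l = (\<Sum>t | t \<in> I \<and> ?f t \<noteq> 0. ?f t)"
  proof (cases "(i, j, l) \<in> (\<lambda>t. (p t, q t, r t)) ` I")
    case True
    then obtain t where t: "t \<in> I" "p t = i" "q t = j" "r t = l" by auto
    have "{s \<in> I. ?f s \<noteq> 0} = (if c t = 0 then {} else {t})"
      using t inj_onD[OF inj] by (auto split: if_splits)
    then show ?thesis using coeff[OF t(1)] t by simp
  next
    case False
    then have "{s \<in> I. ?f s \<noteq> 0} = {}" by (auto split: if_splits)
    then show ?thesis unfolding zero[OF False] by (simp only: sum.empty finite.emptyI)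
  qed
qed

theorem theorem1p6:
  fixes a b :: "nat \<Rightarrow> nat \<Rightarrow> nat \<Rightarrow> nat"
  assumes "twin_seidel a b"
  shows "fps3_has_sum
           (\<lambda>(n, m, k).
              fps3_const (of_nat (b (2 * n + 1) m k) / (fact (m - 1) * fact (k - m - 1) * fact (2 * n - k)))
              * X3 ^ (m - 1) * Y3 ^ (k - m - 1) * Z3 ^ (2 * n - k))
           {(n, m, k). 1 \<le> n \<and> 2 \<le> m + 1 \<and> m + 1 \<le> k \<and> k \<le> 2 * n}
           (fps3_sin X3 * fps3_cos Z3 * fps3_sin (X3 + Y3 + Z3) / (fps3_cos (X3 + Y3 + Z3))\<^sup>2) \<and>
         fps3_has_sum
           (\<lambda>(n, m, k).
              fps3_const (of_nat (b (2 * n + 1) m k) / (fact (2 * n - m) * fact (m - k - 1) * fact (k - 1)))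
              * X3 ^ (2 * n - m) * Y3 ^ (m - k - 1) * Z3 ^ (k - 1))
           {(n, m, k). 1 \<le> n \<and> 2 \<le> k + 1 \<and> k + 1 \<le> m \<and> m \<le> 2 * n}
           (- (fps3_sin X3 * fps3_sin Z3 / fps3_cos (X3 + Y3 + Z3))
            + fps3_cos X3 * fps3_cos (X3 + Y3) / (fps3_cos (X3 + Y3 + Z3))\<^sup>2)"
proof -
  let ?C = "fps3_cos (X3 + Y3 + Z3)" and ?S = "fps3_sin (X3 + Y3 + Z3)"
  define T where "T = 1 / ?C"
  have T: "T * ?C = 1"
    unfolding T_def by (rule fps3_divide[OF fps3_cos_const_nonzero])
  have div1: "F / ?C = F * T" for F
  proof -
    have "F / ?C = F / ?C * ?C * T" using T by (simp add: mult.assoc mult.commute)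
    then show ?thesis by (simp add: fps3_divide[OF fps3_cos_const_nonzero])
  qed
  have nz: "(?C\<^sup>2) $ 0 $ 0 $ 0 \<noteq> 0"
    using fps3_cos_const_nonzero[of "X3 + Y3 + Z3"] by (simp add: power2_eq_square)
  have div2: "F / ?C\<^sup>2 = F * T * T" for F
  proof -
    have "F / ?C\<^sup>2 = F / ?C\<^sup>2 * (T * ?C) * (T * ?C)" by (simp add: T)
    also have "\<dots> = F / ?C\<^sup>2 * ?C\<^sup>2 * T * T" by (simp only: power2_eq_square mult_ac)
    finally show ?thesis by (simp only: fps3_divide[OF nz])
  qed
  let ?Bu = "sx * cz * ?S * T * T" and ?Bl = "cx * (cx * cy - sx * sy) * T * T - sx * sz * T"
  have rhs: "fps3_sin X3 * fps3_cos Z3 * ?S / ?C\<^sup>2 = ?Bu"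
    "- (fps3_sin X3 * fps3_sin Z3 / ?C) + fps3_cos X3 * fps3_cos (X3 + Y3) / ?C\<^sup>2 = ?Bl"
    unfolding div1 div2 fps3_cos_XY by (simp_all add: fps3_sin_def fps3_cos_def fps3_compose_X3 fps3_compose_Z3)
  \<comment> \<open>Both families satisfy the same determining relations, so uniqueness identifies
    them.\<close>
  have egf: "fps3_egf ?Bu i j l = upper_entries even b i j l"
    "fps3_egf ?Bl i j l = lower_entries even b i j l" for i j l
    using seidel_relations_unique[OF trig_seidel_relations[OF T[unfolded fps3_cos_XYZ]]
        twin_seidel_relations[OF assms], of i j l]
    by (simp_all add: fps3_sin_XYZ)
  have nth: "?Bu $ i $ j $ l = upper_entries even b i j l / (fact i * fact j * fact l)"
    "?Bl $ i $ j $ l = lower_entries even b i j l / (fact i * fact j * fact l)" for i j l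
    unfolding egf[symmetric] by (simp_all add: fps3_egf_def)
  let ?Iu = "{(n, m, k). 1 \<le> n \<and> 2 \<le> m + 1 \<and> m + 1 \<le> k \<and> k \<le> 2 * n} :: (nat \<times> nat \<times> nat) set"
  let ?Il = "{(n, m, k). 1 \<le> n \<and> 2 \<le> k + 1 \<and> k + 1 \<le> m \<and> m \<le> 2 * n} :: (nat \<times> nat \<times> nat) set"
  have "fps3_has_sum
      (\<lambda>t. fps3_const (case t of (n, m, k) \<Rightarrow>
             of_nat (b (2 * n + 1) m k) / (fact (m - 1) * fact (k - m - 1) * fact (2 * n - k)))
         * X3 ^ (case t of (n, m, k) \<Rightarrow> m - 1) * Y3 ^ (case t of (n, m, k) \<Rightarrow> k - m - 1)
         * Z3 ^ (case t of (n, m, k) \<Rightarrow> 2 * n - k)) ?Iu ?Bu"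
  proof (rule fps3_has_sum_monomials, goal_cases)
    case 1
    show ?case by (auto simp: inj_on_def)
  next
    case (2 t)
    obtain n m k where t: "t = (n, m, k)" by (cases t)
    define i j l where "i = m - 1" and "j = k - m - 1" and "l = 2 * n - k"
    have "m = Suc i" "k = Suc (Suc (i + j))" "2 * n = Suc (Suc (i + j + l))"
      using 2 by (auto simp: t i_def j_def l_def)
    moreover from this(3) have "even (i + j + l)" by presburger
    ultimately show ?case
      unfolding nth by (simp add: t upper_entries_def del: even_add)
  next
    case (3 i j l)
    \<comment> \<open>Every exponent triple of even degree 2r occurs: solving for (n, m, k) gives (r
      + 1, i + 1, i + j + 2). The missing triples have odd degree, where the parity filter gives
      0.\<close>
    have "odd (i + j + l)"
    proof
      assume "even (i + j + l)"
      then obtain r where "i + j + l = 2 * r" by blast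
      then have "(i, j, l) \<in> (\<lambda>t. (case t of (n, m, k) \<Rightarrow> m - 1, case t of (n, m, k) \<Rightarrow> k - m - 1,
          case t of (n, m, k) \<Rightarrow> 2 * n - k)) ` ?Iu"
        by (intro image_eqI[of _ _ "(r + 1, i + 1, i + j + 2)"]) simp_all
      with 3 show False by contradiction
    qed
    then show ?case unfolding nth by (simp add: upper_entries_def del: even_add odd_add)
  qed
  moreover have "fps3_has_sum
      (\<lambda>t. fps3_const (case t of (n, m, k) \<Rightarrow>
             of_nat (b (2 * n + 1) m k) / (fact (2 * n - m) * fact (m - k - 1) * fact (k - 1)))
         * X3 ^ (case t of (n, m, k) \<Rightarrow> 2 * n - m) * Y3 ^ (case t of (n, m, k) \<Rightarrow> m - k - 1)
         * Z3 ^ (case t of (n, m, k) \<Rightarrow> k - 1)) ?Il ?Bl"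
  proof (rule fps3_has_sum_monomials, goal_cases)
    case 1
    show ?case by (auto simp: inj_on_def)
  next
    case (2 t)
    obtain n m k where t: "t = (n, m, k)" by (cases t)
    define i j l where "i = 2 * n - m" and "j = m - k - 1" and "l = k - 1"
    have "m = Suc (Suc (j + l))" "k = Suc l" "2 * n = Suc (Suc (i + j + l))"
      using 2 by (auto simp: t i_def j_def l_def)
    moreover from this(3) have "even (i + j + l)" by presburger
    ultimately show ?case
      unfolding nth by (simp add: t lower_entries_def del: even_add)
  next
    case (3 i j l)
    \<comment> \<open>Below the diagonal the exponents (2n - m, m - k - 1, k - 1) are inverted by (r
      + 1, j + l + 2, l + 1).\<close>
    have "odd (i + j + l)"
    proof
      assume "even (i + j + l)"
      then obtain r where "i + j + l = 2 * r" by blast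
      then have "(i, j, l) \<in> (\<lambda>t. (case t of (n, m, k) \<Rightarrow> 2 * n - m, case t of (n, m, k) \<Rightarrow> m - k - 1,
          case t of (n, m, k) \<Rightarrow> k - 1)) ` ?Il"
        by (intro image_eqI[of _ _ "(r + 1, j + l + 2, l + 1)"]) simp_all
      with 3 show False by contradiction
    qed
    then show ?case unfolding nth by (simp add: lower_entries_def del: even_add odd_add)
  qed
  ultimately show ?thesis
    unfolding rhs by (simp add: case_prod_unfold)
qed

end
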